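(* Let $(G,b,m)$, $G=(V,\vec E)$, be a finite connected weighted directed graph satisfying the standing assumptions in the context, with $\#V=n$. Let $G_1=(V,\vec E_1)$ and $G_2=(V,\vec E_2)$ be partial graphs of $G$ such that $E=E_1\sqcup E_2$ (disjoint union). Then for all $k=1,\dots,n$ and $r,s\in\{1,2\}$ with $r\neq s$: $$\lambda_k(S_G)\le \lambda_{k+j}(S_{G_s})+\lambda_{n-j}(S_{G_r})\qquad\text{for } j=0,\dots,n-k,$$ and $$\lambda_k(S_G)\ge \lambda_{k-j+1}(S_{G_s})+\lambda_{j}(S_{G_r})\qquad\text{for } j=1,\dots,k.$$
   Context: Setting. $G=(V,\vec E)$ is a directed graph with $V$ a finite nonempty set and $\vec E\subset V\times V$; $b:V\times V\to[0,\infty)$ satisfies $b(x,x)=0$ for all $x$ and $b(x,y)>0$ iff $(x,y)\in\vec E$; $m:V\to(0,\infty)$. Put $V_x^+=\{y:(x,y)\in\vec E\}$, $V_x^-=\{y:(y,x)\in\vec E\}$, $V_x=V_x^+\cup V_x^-$. Standing assumptions on $G$: (i) connected: any two vertices are always related by a (directed) path; (ii) $V_x^+\ne\emptyset$ and $V_x^-\neq\emptyset$ for all $x$; (iii) Assumption $(\beta)$: $\sum_{y\in V_x^+}b(x,y)=\sum_{y\in V_x^-}b(y,x)$ for all $x\in V$. Functions $f:V\to\mathbb C$ carry the inner product $(f,g)_m=\sum_{x}m(x)f(x)\overline{g(x)}$. With $a(x,y)=b(x,y)+b(y,x)$, the special Laplacian is the self-adjoint operator $S_Gf(x)=\frac1{m(x)}\sum_{y\in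 V_x}a(x,y)(f(x)-f(y))$. Its eigenvalues $\lambda_1(S_G)\le\dots\le\lambda_n(S_G)$ are listed in nondecreasing order with multiplicity. A partial graph of $G$ is $G_1=(V,\vec E_1)$ with $\vec E_1\subset\vec E$. It carries the same $m$ and the weight $b_1$ equal to $b$ on $\vec E_1$ and $0$ elsewhere; $S_{G_1}$ is given by the same formula with $b_1$ in place of $b$. For a directed edge set $\vec F$, the set of undirected edges is $F=\{\{x,y\}:(x,y)\in\vec F\text{ or }(y,x)\in\vec F\}$; $E,E_1,E_2$ are those of $\vec E,\vec E_1,\vec E_2$.
   Formalization: The upper bounds are proved only when the directed edge sets of the two partial graphs together cover all directed edges of G; with only the undirected sets partitioned they can fail (two vertices joined by both arcs, one arc kept in G_1, none in G_2). The lower bounds are as stated. *)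

theory Defs
  imports "HOL-Analysis.Analysis"
begin

text \<open>The vertex set is the universe of a finite type \<open>'v\<close>, so the number of vertices is
  \<open>CARD('v)\<close>, complex functions on the vertices are the elements of \<open>complex ^ 'v\<close>, and a
  directed graph is given by its edge set.\<close>

definition out_nbrs :: "('v \<times> 'v) set \<Rightarrow> 'v \<Rightarrow> 'v set" where
  "out_nbrs E x = {y. (x, y) \<in> E}"

definition in_nbrs :: "('v \<times> 'v) set \<Rightarrow> 'v \<Rightarrow> 'v set" where
  "in_nbrs E x = {y. (y, x) \<in> E}"

definition nbrs :: "('v \<times> 'v) set \<Rightarrow> 'v \<Rightarrow> 'v set" where
  "nbrs E x = out_nbrs E x \<union> in_nbrs E x"

definition undirected_edges :: "('v \<times> 'v) set \<Rightarrow> 'v set set" where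
  "undirected_edges F = {{x, y} | x y. (x, y) \<in> F \<or> (y, x) \<in> F}"

locale weighted_digraph =
  fixes E :: "('v::finite \<times> 'v) set"
    and b :: "'v \<Rightarrow> 'v \<Rightarrow> real"
    and m :: "'v \<Rightarrow> real"
  assumes b_nonneg: "0 \<le> b x y"
    and b_diag: "b x x = 0"
    and b_pos_iff: "0 < b x y \<longleftrightarrow> (x, y) \<in> E"
    and m_pos: "0 < m x"

text \<open>A graph with a single vertex has no edges and is excluded by \<open>out_nonempty\<close>; hence
  admitting the path of length 0 in \<open>connected\<close> makes no difference.  The last assumption is
  Assumption \<open>(\<beta>)\<close>.\<close>

locale standing_digraph = weighted_digraph E b m
  for E :: "('v::finite \<times> 'v) set" and b m +
  assumes connected: "(x, y) \<in> E\<^sup>*"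
    and out_nonempty: "out_nbrs E x \<noteq> {}"
    and in_nonempty: "in_nbrs E x \<noteq> {}"
    and balanced: "(\<Sum>y\<in>out_nbrs E x. b x y) = (\<Sum>y\<in>in_nbrs E x. b y x)"

definition partial_weight :: "('v \<Rightarrow> 'v \<Rightarrow> real) \<Rightarrow> ('v \<times> 'v) set \<Rightarrow> 'v \<Rightarrow> 'v \<Rightarrow> real" where
  "partial_weight b F x y = (if (x, y) \<in> F then b x y else 0)"

definition special_laplacian ::
  "('v::finite \<times> 'v) set \<Rightarrow> ('v \<Rightarrow> 'v \<Rightarrow> real) \<Rightarrow> ('v \<Rightarrow> real) \<Rightarrow> complex ^ 'v \<Rightarrow> complex ^ 'v"
where
  "special_laplacian E b m f =
     (\<chi> x. complex_of_real (1 / m x) *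
        (\<Sum>y\<in>nbrs E x. complex_of_real (b x y + b y x) * (f $ x - f $ y)))"

definition eigenspace :: "(complex ^ 'v \<Rightarrow> complex ^ 'v) \<Rightarrow> real \<Rightarrow> (complex ^ 'v) set" where
  "eigenspace S \<mu> = {f. S f = complex_of_real \<mu> *s f}"

text \<open>The next two definitions are meant for operators that are self-adjoint with respect to
  some inner product, such as the special Laplacian with respect to \<open>(f, g)\<^sub>m\<close>: then all
  eigenvalues are real, and the multiplicity is the complex dimension of the eigenspace.
  The numbering \<open>\<lambda>\<^sub>1, \<lambda>\<^sub>2, \<dots>\<close> starts at 1.\<close>

definition eigenvalue_list :: "(complex ^ 'v::finite \<Rightarrow> complex ^ 'v) \<Rightarrow> real list" where
  "eigenvalue_list S =
     concat (map (\<lambda>\<mu>. replicate (vec.dim (eigenspace S \<mu>)) \<mu>)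
       (sorted_list_of_set {\<mu>. \<exists>f. f \<noteq> 0 \<and> f \<in> eigenspace S \<mu>}))"

definition nth_eigenvalue :: "nat \<Rightarrow> (complex ^ 'v::finite \<Rightarrow> complex ^ 'v) \<Rightarrow> real" where
  "nth_eigenvalue k S = eigenvalue_list S ! (k - 1)"

text \<open>Pitfall: if the undirected edges of \<open>F\<^sub>1\<close> and \<open>F\<^sub>2\<close> partition those of \<open>E\<close>, then \<open>F\<^sub>1\<close> and
  \<open>F\<^sub>2\<close> need not cover \<open>E\<close>, because for an antiparallel pair \<open>(x, y), (y, x)\<close> in \<open>E\<close> it is enough
  that one of the two arcs is kept.  In that case the special Laplacian of \<open>E\<close> is not the sum of
  those of \<open>F\<^sub>1\<close> and \<open>F\<^sub>2\<close>, and the upper bounds of Weyl type for its eigenvalues can fail: take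
  two vertices, \<open>m = 1\<close>, \<open>E\<close> an antiparallel pair with \<open>b = 1\<close>, \<open>F\<^sub>1\<close> one of its arcs and
  \<open>F\<^sub>2 = {}\<close>.  The spectra are \<open>0, 4\<close> and \<open>0, 2\<close> and \<open>0, 0\<close>.\<close>

end

theory Submission
  imports Defs
begin

text \<open>Each operator has an orthogonal eigenbasis, because a maximiser of the Rayleigh quotient
  on an invariant subspace is an eigenvector.  The eigenvectors with eigenvalue at most (at least)
  the \<open>k\<close>-th one span a space of dimension at least \<open>k\<close> (at least \<open>n - k + 1\<close>) on which the
  Rayleigh quotient is bounded above (below) by that eigenvalue.  Choosing one such space for each
  of the three Laplacians, the dimensions add up to at least \<open>2n + 1\<close>, so the spaces share a
  nonzero vector, and testing the inequality between the quadratic forms on this vector gives the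
  claim.  For the lower bounds, \<open>Q\<^sub>1 + Q\<^sub>2 \<le> Q\<close> suffices, which holds even if \<open>F\<^sub>1\<close> and \<open>F\<^sub>2\<close> do
  not cover \<open>E\<close>; the upper bounds use equality.\<close>

section \<open>The weighted inner product\<close>

definition wip :: "('v \<Rightarrow> real) \<Rightarrow> complex ^ 'v::finite \<Rightarrow> complex ^ 'v \<Rightarrow> complex" where
  "wip m f g = (\<Sum>x\<in>UNIV. complex_of_real (m x) * f $ x * cnj (g $ x))"

definition wnorm2 :: "('v \<Rightarrow> real) \<Rightarrow> complex ^ 'v::finite \<Rightarrow> real" where
  "wnorm2 m f = (\<Sum>x\<in>UNIV. m x * (cmod (f $ x))\<^sup>2)"

lemma wip_add_left: "wip m (f + g) h = wip m f h + wip m g h"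
  and wip_add_right: "wip m h (f + g) = wip m h f + wip m h g"
  and wip_diff_left: "wip m (f - g) h = wip m f h - wip m g h"
  by (simp_all add: wip_def algebra_simps sum.distrib sum_subtractf)

lemma wip_scale_left: "wip m (c *s f) h = c * wip m f h"
  and wip_scale_right: "wip m h (c *s f) = cnj c * wip m h f"
  by (simp_all add: wip_def algebra_simps sum_distrib_left)

lemma wip_zero_left [simp]: "wip m 0 h = 0"
  and wip_zero_right [simp]: "wip m h 0 = 0"
  by (simp_all add: wip_def)

lemma wip_sum_left: "wip m (\<Sum>i\<in>I. f i) h = (\<Sum>i\<in>I. wip m (f i) h)"
  by (induction I rule: infinite_finite_induct) (auto simp: wip_add_left)

lemma wip_sum_right: "wip m h (\<Sum>i\<in>I. f i) = (\<Sum>i\<in>I. wip m h (f i))"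
  by (induction I rule: infinite_finite_induct) (auto simp: wip_add_right)

lemma wip_commute: "wip m g f = cnj (wip m f g)"
  by (simp add: wip_def mult_ac)

lemma wip_self: "wip m f f = complex_of_real (wnorm2 m f)"
  by (simp add: wip_def wnorm2_def mult.assoc flip: complex_norm_square)

lemma wnorm2_scale: "wnorm2 m (c *s f) = (cmod c)\<^sup>2 * wnorm2 m f"
  by (simp add: wnorm2_def norm_mult power_mult_distrib sum_distrib_left mult_ac)

lemma wnorm2_pos:
  fixes f :: "complex ^ 'v::finite"
  assumes "\<And>x. 0 < m x" "f \<noteq> 0"
  shows "0 < wnorm2 m f"
proof -
  obtain x where "f $ x \<noteq> 0"
    using assms(2) by (auto simp: vec_eq_iff)
  then show ?thesis
    unfolding wnorm2_def using assms(1)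
    by (intro sum_pos2[of _ x]) (auto simp: less_imp_le)
qed

lemma scaleR_eq_smult: "c *\<^sub>R f = complex_of_real c *s (f :: complex ^ 'v)"
  unfolding vec_eq_iff by (simp add: scaleR_conv_of_real[where 'a = complex])

lemma continuous_on_wnorm2: "continuous_on A (wnorm2 m)"
  unfolding wnorm2_def by (intro continuous_intros)

text \<open>A complex subspace is also a real one, and these are closed in finite dimension. This
  makes the unit sphere of the subspace compact.\<close>

lemma closed_complex_subspace:
  fixes W :: "(complex ^ 'v::finite) set"
  assumes "vec.subspace W"
  shows "closed W"
proof (rule closed_subspace)
  show "subspace W"
    using assms by (auto simp: subspace_def vec.subspace_def scaleR_eq_smult)
qed

section \<open>Self-adjoint operators\<close>

text \<open>Near \<open>t = 0\<close> the linear term dominates and changes sign with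
  \<open>t\<close>, so it must vanish. This is the first-order condition at a maximum.\<close>

lemma linear_coeff_zero:
  fixes p q :: real
  assumes "\<And>t. 2 * t * p + t\<^sup>2 * q \<le> 0"
  shows "p = 0"
proof (rule ccontr)
  assume "p \<noteq> 0"
  \<comment> \<open>The sign of \<open>t\<close> agrees with that of \<open>p\<close>, and
    \<open>t\<close> is so small that the quadratic term cannot outweigh
    \<open>2 * t * p\<close>.\<close>
  define t where "t = p / (1 + \<bar>q\<bar>)"
  have "2 * t * p + t\<^sup>2 * q = p\<^sup>2 / (1 + \<bar>q\<bar>)\<^sup>2 * (2 * (1 + \<bar>q\<bar>) + q)"
    by (simp add: t_def divide_simps power2_eq_square) (simp add: algebra_simps)
  also have "\<dots> > 0"
    using \<open>p \<noteq> 0\<close> by (intro mult_pos_pos divide_pos_pos) auto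
  finally show False
    using assms[of t] by simp
qed

lemma sorted_concat_replicate:
  fixes xs :: "'a::linorder list"
  assumes "sorted xs"
  shows "sorted (concat (map (\<lambda>x. replicate (d x) x) xs))"
  using assms by (induction xs) (auto simp: sorted_append)

section \<open>Quadratic forms and maximisers of the Rayleigh quotient\<close>

locale selfadjoint =
  fixes m :: "'v::finite \<Rightarrow> real" and S :: "complex ^ 'v \<Rightarrow> complex ^ 'v"
  assumes weight_pos: "0 < m x"
    and add: "S (f + g) = S f + S g"
    and smult: "S (c *s f) = c *s S f"
    and symmetric: "wip m (S f) g = wip m f (S g)"
begin

text \<open>By symmetry \<open>wip m (S f) f\<close> is already real; \<open>Re\<close> only moves
  it to an ordered type.\<close>

definition qform :: "complex ^ 'v \<Rightarrow> real" where
  "qform f = Re (wip m (S f) f)"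

lemma zero: "S 0 = 0"
  using smult[of 0 0] by simp

lemma sum: "S (\<Sum>i\<in>I. f i) = (\<Sum>i\<in>I. S (f i))"
  by (induction I rule: infinite_finite_induct) (auto simp: add zero)

lemma qform_scale: "qform (c *s f) = (cmod c)\<^sup>2 * qform f"
proof -
  have "wip m (S (c *s f)) (c *s f) = complex_of_real ((cmod c)\<^sup>2) * wip m (S f) f"
    by (simp add: smult wip_scale_left wip_scale_right complex_norm_square del: of_real_power)
  from arg_cong[OF this, of Re] show ?thesis
    by (simp add: qform_def del: of_real_power)
qed

lemma continuous_on_qform: "continuous_on A qform"
proof -
  have "linear S"
    by (intro linearI) (simp_all add: add smult scaleR_eq_smult)
  then have "continuous_on A S"
    using linear_continuous_on linear_conv_bounded_linear by blast
  then show ?thesis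
    unfolding qform_def wip_def by (intro continuous_intros)
qed

text \<open>The two cross terms are complex conjugates by symmetry, so their real parts
  coincide.\<close>

lemma qform_shift:
  "qform (v + complex_of_real t *s g) =
     qform v + 2 * t * Re (wip m (S v) g) + t\<^sup>2 * qform g"
proof -
  have "Re (wip m (S g) v) = Re (wip m (S v) g)"
    using wip_commute[of m "S g" v] by (simp add: symmetric)
  then show ?thesis
    by (simp add: qform_def add smult wip_add_left wip_add_right wip_scale_left wip_scale_right
        algebra_simps power2_eq_square)
qed

lemma wnorm2_shift:
  "wnorm2 m (v + complex_of_real t *s g) =
     wnorm2 m v + 2 * t * Re (wip m v g) + t\<^sup>2 * wnorm2 m g"
proof -
  have w: "wnorm2 m f = Re (wip m f f)" for f
    by (simp add: wip_self)
  have "Re (wip m g v) = Re (wip m v g)"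
    using wip_commute[of m g v] by simp
  then show ?thesis
    by (simp add: w wip_add_left wip_add_right wip_scale_left wip_scale_right
        algebra_simps power2_eq_square)
qed

text \<open>The quotient is continuous on the compact unit sphere of \<open>W\<close> and attains a
  maximum there. Both forms scale by \<open>(cmod c)\<^sup>2\<close>, so the bound extends to all of
  \<open>W\<close>.\<close>

lemma rayleigh_maximum:
  assumes W: "vec.subspace W" and "W \<noteq> {0}"
  obtains v \<mu> where "v \<in> W" "v \<noteq> 0" "qform v = \<mu> * wnorm2 m v"
    "\<And>f. f \<in> W \<Longrightarrow> qform f \<le> \<mu> * wnorm2 m f"
proof -
  \<comment> \<open>This sphere is taken in the standard norm. The weighted norm need only be
    positive on it, because the quotient is invariant under scaling.\<close>
  define K where "K = W \<inter> sphere 0 1"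
  have unit: "complex_of_real (inverse (norm f)) *s f \<in> K" if "f \<in> W" "f \<noteq> 0" for f
    using that vec.subspace_scale[OF W, of f "complex_of_real (inverse (norm f))"]
    unfolding scaleR_eq_smult[symmetric] by (simp add: K_def)
  have "compact K"
    unfolding K_def by (intro closed_Int_compact closed_complex_subspace W compact_sphere)
  moreover have "K \<noteq> {}"
  proof -
    have "0 \<in> W"
      using W by (rule vec.subspace_0)
    then obtain f where "f \<in> W" "f \<noteq> 0"
      using \<open>W \<noteq> {0}\<close> by blast
    then show ?thesis
      using unit by blast
  qed
  moreover have pos: "0 < wnorm2 m f" if "f \<in> K" for f
    using that wnorm2_pos[of m f, OF weight_pos] by (force simp: K_def)
  then have "continuous_on K (\<lambda>f. qform f / wnorm2 m f)"
    by (intro continuous_intros continuous_on_qform continuous_on_wnorm2) force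
  ultimately obtain v where v: "v \<in> K"
    and max: "\<forall>f\<in>K. qform f / wnorm2 m f \<le> qform v / wnorm2 m v"
    using continuous_attains_sup[of K "\<lambda>f. qform f / wnorm2 m f"] by blast
  define \<mu> where "\<mu> = qform v / wnorm2 m v"
  show thesis
  proof
    show "v \<in> W" "v \<noteq> 0"
      using v by (auto simp: K_def)
    show "qform v = \<mu> * wnorm2 m v"
      using pos[OF v] by (simp add: \<mu>_def)
    fix f assume f: "f \<in> W"
    show "qform f \<le> \<mu> * wnorm2 m f"
    proof (cases "f = 0")
      case True
      then show ?thesis
        by (simp add: qform_def wnorm2_def)
    next
      case False
      define c where "c = complex_of_real (inverse (norm f))"
      have "c \<noteq> 0"
        using False by (simp add: c_def)
      have "c *s f \<in> K"
        using unit[OF f False] by (simp add: c_def)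
      then have "qform (c *s f) \<le> \<mu> * wnorm2 m (c *s f)"
        using bspec[OF max, of "c *s f"] pos[of "c *s f"] by (simp add: \<mu>_def divide_le_eq)
      then have "(cmod c)\<^sup>2 * qform f \<le> (cmod c)\<^sup>2 * (\<mu> * wnorm2 m f)"
        by (simp add: qform_scale wnorm2_scale mult_ac)
      then show ?thesis
        using \<open>c \<noteq> 0\<close> by (simp add: mult_le_cancel_left)
    qed
  qed
qed

text \<open>At a maximiser \<open>v\<close>, vary in the direction of the residual
  \<open>g = S v - \<mu> v\<close>, which stays in \<open>W\<close> by invariance. The first-order
  condition says that \<open>Re (wip m g g)\<close> vanishes, so \<open>g = 0\<close>.\<close>

lemma eigenvector_in_invariant:
  assumes W: "vec.subspace W" and "W \<noteq> {0}" and inv: "\<And>f. f \<in> W \<Longrightarrow> S f \<in> W"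
  obtains v \<mu> where "v \<in> W" "v \<noteq> 0" "S v = complex_of_real \<mu> *s v"
proof -
  obtain v \<mu> where v: "v \<in> W" "v \<noteq> 0" "qform v = \<mu> * wnorm2 m v"
    and max: "\<And>f. f \<in> W \<Longrightarrow> qform f \<le> \<mu> * wnorm2 m f"
    using rayleigh_maximum[OF W \<open>W \<noteq> {0}\<close>] by metis
  define g where "g = S v - complex_of_real \<mu> *s v"
  have g: "g \<in> W"
    unfolding g_def using v inv W by (intro vec.subspace_diff vec.subspace_scale)
  have "Re (wip m (S v) g) - \<mu> * Re (wip m v g) = 0"
  proof (rule linear_coeff_zero)
    fix t
    have "v + complex_of_real t *s g \<in> W"
      using v g W by (intro vec.subspace_add vec.subspace_scale)
    from max[OF this] v(3)
    show "2 * t * (Re (wip m (S v) g) - \<mu> * Re (wip m v g)) +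
        t\<^sup>2 * (qform g - \<mu> * wnorm2 m g) \<le> 0"
      by (simp add: qform_shift wnorm2_shift algebra_simps)
  qed
  then have "Re (wip m g g) = 0"
    by (subst (1) g_def) (simp add: wip_diff_left wip_scale_left)
  then have "g = 0"
    using wnorm2_pos[of m g, OF weight_pos] by (fastforce simp: wip_self)
  then show thesis
    using that v by (simp add: g_def)
qed

end

section \<open>Orthogonal families and eigenbases\<close>

definition orthogonal_family :: "('v \<Rightarrow> real) \<Rightarrow> (complex ^ 'v::finite) set \<Rightarrow> bool" where
  "orthogonal_family m B \<longleftrightarrow> 0 \<notin> B \<and> (\<forall>v\<in>B. \<forall>w\<in>B. v \<noteq> w \<longrightarrow> wip m v w = 0)"

lemma wip_orthogonal_sum:
  assumes "orthogonal_family m B" "finite B" "w \<in> B"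
  shows "wip m (\<Sum>v\<in>B. c v *s v) w = c w * wip m w w"
proof -
  have "wip m (\<Sum>v\<in>B. c v *s v) w = (\<Sum>v\<in>B. if v = w then c w * wip m w w else 0)"
    unfolding wip_sum_left wip_scale_left using assms
    by (intro sum.cong) (auto simp: orthogonal_family_def)
  then show ?thesis
    using assms by simp
qed

text \<open>Pairing a linear relation with one of its members \<open>w\<close> isolates the
  coefficient of \<open>w\<close>; as \<open>w\<close> is nonzero, that coefficient
  vanishes.\<close>

lemma orthogonal_family_independent:
  fixes B :: "(complex ^ 'v::finite) set"
  assumes pos: "\<And>x. 0 < m x" and B: "orthogonal_family m B"
  shows "vec.independent B"
proof
  assume "vec.dependent B"
  then obtain T u w where T: "finite T" "T \<subseteq> B" "(\<Sum>v\<in>T. u v *s v) = 0" "w \<in> T" "u w \<noteq> 0"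
    unfolding vec.dependent_explicit by blast
  have "orthogonal_family m T"
    using B T by (auto simp: orthogonal_family_def)
  then have "u w * wip m w w = 0"
    using wip_orthogonal_sum[of m T w u] T by simp
  moreover have "w \<noteq> 0"
    using B T by (auto simp: orthogonal_family_def)
  ultimately show False
    using T wnorm2_pos[of m w, OF pos] by (simp add: wip_self)
qed

context selfadjoint
begin

definition eigenbasis :: "(complex ^ 'v) set \<Rightarrow> (complex ^ 'v \<Rightarrow> real) \<Rightarrow> bool" where
  "eigenbasis B e \<longleftrightarrow> orthogonal_family m B \<and> vec.span B = UNIV \<and>
     (\<forall>v\<in>B. S v = complex_of_real (e v) *s v)"

text \<open>Take an orthogonal set of eigenvectors of maximal size. Its orthogonal complement is
  invariant by symmetry, so a nonzero complement would supply a further eigenvector.\<close>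

lemma exists_eigenbasis: "\<exists>B e. eigenbasis B e"
proof -
  define P where "P B \<longleftrightarrow> orthogonal_family m B \<and>
    (\<forall>v\<in>B. \<exists>\<mu>. S v = complex_of_real \<mu> *s v)" for B
  have bound: "finite B \<and> card B < Suc CARD('v)" if "P B" for B
    using vec.independent_bound_general[of B] orthogonal_family_independent[of m B, OF weight_pos]
      that dim_subset_UNIV_cart_gen[of B] by (auto simp: P_def dest: order_trans)
  have "P {}"
    by (auto simp: P_def orthogonal_family_def)
  \<comment> \<open>A largest set exists because orthogonal families are independent, hence have at
    most \<open>CARD('v)\<close> elements.\<close>
  then obtain B where B: "P B" and max: "\<And>C. P C \<Longrightarrow> card C \<le> card B"
    using ex_has_greatest_nat[of P "{}" card "Suc CARD('v)"] bound by (metis less_imp_le)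
  have orth: "orthogonal_family m B" and "finite B"
    using B bound by (auto simp: P_def)
  define W where "W = {f. \<forall>v\<in>B. wip m f v = 0}"
  have W: "vec.subspace W"
    by (auto simp: W_def vec.subspace_def wip_add_left wip_scale_left)
  have inv: "S f \<in> W" if "f \<in> W" for f
  proof -
    have "wip m (S f) v = 0" if "v \<in> B" for v
    proof -
      obtain \<mu> where "S v = complex_of_real \<mu> *s v"
        using B \<open>v \<in> B\<close> by (auto simp: P_def)
      then show ?thesis
        using \<open>f \<in> W\<close> \<open>v \<in> B\<close> by (simp add: symmetric wip_scale_right W_def)
    qed
    then show ?thesis
      by (simp add: W_def)
  qed
  have "W = {0}"
  proof (rule ccontr)
    assume "W \<noteq> {0}"
    then obtain v \<mu> where v: "v \<in> W" "v \<noteq> 0" "S v = complex_of_real \<mu> *s v"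
      using eigenvector_in_invariant[OF W _ inv] by metis
    have "wip m v w = 0" "wip m w v = 0" if "w \<in> B" for w
      using v that wip_commute[of m w v] by (auto simp: W_def)
    then have "P (insert v B)"
      using v B by (auto simp: P_def orthogonal_family_def)
    moreover have "v \<notin> B"
      using v wnorm2_pos[of m v, OF weight_pos] by (auto simp: W_def wip_self)
    ultimately show False
      using max[of "insert v B"] \<open>finite B\<close> by simp
  qed
  have "f \<in> vec.span B" for f
  proof -
    \<comment> \<open>The orthogonal projection of \<open>f\<close> onto the span of
      \<open>B\<close>; the remainder \<open>f - p\<close> lies in \<open>W = {0}\<close>.\<close>
    define p where "p = (\<Sum>v\<in>B. (wip m f v / wip m v v) *s v)"
    have "wip m (f - p) w = 0" if "w \<in> B" for w
    proof -
      have "w \<noteq> 0"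
        using that orth by (auto simp: orthogonal_family_def)
      then have "wip m w w \<noteq> 0"
        using wnorm2_pos[of m w, OF weight_pos] by (simp add: wip_self)
      then show ?thesis
        unfolding wip_diff_left p_def using wip_orthogonal_sum[OF orth \<open>finite B\<close> that] by simp
    qed
    then have "f - p \<in> W"
      by (simp add: W_def)
    then have "f = p"
      using \<open>W = {0}\<close> by simp
    then show ?thesis
      by (metis (no_types, lifting) p_def vec.span_base vec.span_scale vec.span_sum)
  qed
  moreover obtain e where "\<forall>v\<in>B. S v = complex_of_real (e v) *s v"
    using B unfolding P_def by metis
  ultimately show ?thesis
    using orth unfolding eigenbasis_def by blast
qed

section \<open>Eigenspaces, multiplicities and the eigenvalue list\<close>

lemma
  assumes "eigenbasis B e"
  shows eigenbasis_independent: "vec.independent B"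
    and eigenbasis_finite: "finite B"
    and eigenbasis_card: "card B = CARD('v)"
proof -
  show ind: "vec.independent B"
    using assms orthogonal_family_independent[of m B, OF weight_pos] by (simp add: eigenbasis_def)
  then show "finite B"
    by (rule vec.finiteI_independent)
  have "vec.dim (vec.span B) = card B"
    using ind by (rule vec.dim_span_eq_card_independent)
  then show "card B = CARD('v)"
    using assms vec_dim_card[where 'a = complex and 'n = 'v] by (simp only: eigenbasis_def)
qed

text \<open>Eigenvectors for different eigenvalues are orthogonal, so an eigenvector for \<mu> has
  coefficient 0 at every basis vector with another eigenvalue.\<close>

lemma eigenspace_eq_span:
  assumes "eigenbasis B e"
  shows "eigenspace S \<mu> = vec.span {v \<in> B. e v = \<mu>}"
proof
  have "vec.subspace (eigenspace S \<mu>)"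
    by (auto simp: vec.subspace_def eigenspace_def zero add smult vector_add_ldistrib mult.commute)
  moreover have "{v \<in> B. e v = \<mu>} \<subseteq> eigenspace S \<mu>"
    using assms by (auto simp: eigenbasis_def eigenspace_def)
  ultimately show "vec.span {v \<in> B. e v = \<mu>} \<subseteq> eigenspace S \<mu>"
    by (intro vec.span_minimal)
next
  have fin: "finite B" and orth: "orthogonal_family m B"
    using assms eigenbasis_finite by (auto simp: eigenbasis_def)
  show "eigenspace S \<mu> \<subseteq> vec.span {v \<in> B. e v = \<mu>}"
  proof
    fix f assume "f \<in> eigenspace S \<mu>"
    then have f: "S f = complex_of_real \<mu> *s f"
      by (simp add: eigenspace_def)
    have "f \<in> vec.span B"
      using assms by (simp add: eigenbasis_def)
    then obtain c where c: "f = (\<Sum>v\<in>B. c v *s v)"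
      unfolding vec.span_finite[OF fin] by blast
    have "c v *s v \<in> vec.span {v \<in> B. e v = \<mu>}" if v: "v \<in> B" for v
    proof (cases "e v = \<mu>")
      case True
      then show ?thesis
        using v by (auto intro: vec.span_scale vec.span_base)
    next
      case False
      have Sv: "S v = complex_of_real (e v) *s v"
        using assms v by (simp add: eigenbasis_def)
      \<comment> \<open>Symmetry evaluates \<open>wip m (S f) v\<close> in two ways; no conjugate
        appears on the right since \<open>e v\<close> is real.\<close>
      have "complex_of_real \<mu> * wip m f v = complex_of_real (e v) * wip m f v"
        using symmetric[of f v] by (simp add: f Sv wip_scale_left wip_scale_right)
      then have "wip m f v = 0"
        using False by simp
      moreover have "wip m f v = c v * wip m v v"
        unfolding c using wip_orthogonal_sum[OF orth fin v] .
      moreover have "v \<noteq> 0"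
        using orth v by (auto simp: orthogonal_family_def)
      ultimately have "c v = 0"
        using wnorm2_pos[of m v, OF weight_pos] by (simp add: wip_self)
      then show ?thesis
        by (simp add: vec.span_zero)
    qed
    then show "f \<in> vec.span {v \<in> B. e v = \<mu>}"
      unfolding c by (rule vec.span_sum)
  qed
qed

lemma dim_eigenspace:
  assumes "eigenbasis B e"
  shows "vec.dim (eigenspace S \<mu>) = card {v \<in> B. e v = \<mu>}"
  unfolding eigenspace_eq_span[OF assms]
  by (intro vec.dim_span_eq_card_independent vec.independent_mono[OF eigenbasis_independent[OF assms]])
    auto

lemma eigenvalues_eq_image:
  assumes "eigenbasis B e"
  shows "{\<mu>. \<exists>f. f \<noteq> 0 \<and> f \<in> eigenspace S \<mu>} = e ` B"
proof (intro equalityI subsetI)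
  fix \<mu> assume "\<mu> \<in> {\<mu>. \<exists>f. f \<noteq> 0 \<and> f \<in> eigenspace S \<mu>}"
  then obtain f where "f \<noteq> 0" "f \<in> vec.span {v \<in> B. e v = \<mu>}"
    unfolding eigenspace_eq_span[OF assms] by blast
  then have "{v \<in> B. e v = \<mu>} \<noteq> {}"
    by (metis singletonD vec.span_empty)
  then show "\<mu> \<in> e ` B"
    by auto
next
  fix \<mu> assume "\<mu> \<in> e ` B"
  then show "\<mu> \<in> {\<mu>. \<exists>f. f \<noteq> 0 \<and> f \<in> eigenspace S \<mu>}"
    using assms by (auto simp: eigenbasis_def orthogonal_family_def eigenspace_def) metis
qed

lemma sorted_eigenvalue_list: "sorted (eigenvalue_list S)"
  unfolding eigenvalue_list_def by (intro sorted_concat_replicate) simp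

text \<open>Each \<mu> is listed as often as basis vectors carry it, so counting list entries
  amounts to counting basis vectors, grouped by the fibres of \<open>e\<close>. This avoids
  enumerating the basis in the order of the list.\<close>

lemma length_filter_eigenvalue_list:
  assumes "eigenbasis B e"
  shows "length (filter P (eigenvalue_list S)) = card {v \<in> B. P (e v)}"
proof -
  have fin: "finite B"
    using assms by (rule eigenbasis_finite)
  have "length (filter P (eigenvalue_list S)) =
      (\<Sum>\<mu>\<in>e ` B. if P \<mu> then card {v \<in> B. e v = \<mu>} else 0)"
    unfolding eigenvalue_list_def eigenvalues_eq_image[OF assms] dim_eigenspace[OF assms]
    using fin
    by (auto simp: filter_concat length_concat filter_replicate o_def if_distrib[of length]
        sum_list_distinct_conv_sum_set cong: if_cong)
  also have "\<dots> = (\<Sum>\<mu>\<in>e ` B. \<Sum>v | v \<in> B \<and> e v = \<mu>. if P (e v) then 1 else 0)"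
    by (intro sum.cong) auto
  also have "\<dots> = (\<Sum>v\<in>B. if P (e v) then 1 else 0)"
    using fin by (rule sum.image_gen[symmetric])
  also have "\<dots> = card {v \<in> B. P (e v)}"
    using fin by (simp add: sum.If_cases Int_def)
  finally show ?thesis .
qed

text \<open>Guarantees that \<open>nth_eigenvalue k S\<close> is a genuine list entry for
  \<open>k\<close> from 1 to \<open>CARD('v)\<close>.\<close>

lemma length_eigenvalue_list: "length (eigenvalue_list S) = CARD('v)"
proof -
  obtain B e where "eigenbasis B e"
    using exists_eigenbasis by blast
  then show ?thesis
    using length_filter_eigenvalue_list[of B e "\<lambda>_. True"] eigenbasis_card by simp
qed

text \<open>In orthogonal coordinates both forms are diagonal with the same nonnegative weights
  \<open>(cmod (c v))\<^sup>2 * wnorm2 m v\<close>, multiplied by \<open>e v\<close> in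
  \<open>qform\<close>. The bounds then hold term by term.\<close>

lemma qform_span_bounds:
  assumes "eigenbasis B e" and C: "C \<subseteq> B" and f: "f \<in> vec.span C"
  shows "(\<And>v. v \<in> C \<Longrightarrow> e v \<le> t) \<Longrightarrow> qform f \<le> t * wnorm2 m f"
    and "(\<And>v. v \<in> C \<Longrightarrow> t \<le> e v) \<Longrightarrow> t * wnorm2 m f \<le> qform f"
proof -
  have fin: "finite C" and orth: "orthogonal_family m C"
    using assms finite_subset[OF C eigenbasis_finite[OF assms(1)]]
    by (auto simp: eigenbasis_def orthogonal_family_def subset_iff)
  obtain c where c: "f = (\<Sum>v\<in>C. c v *s v)"
    using f unfolding vec.span_finite[OF fin] by blast
  have Sf: "S f = (\<Sum>v\<in>C. (c v * complex_of_real (e v)) *s v)"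
    unfolding c sum using assms
    by (intro sum.cong) (auto simp: smult eigenbasis_def)
  have expand: "wip m (\<Sum>v\<in>C. d v *s v) f = (\<Sum>v\<in>C. d v * cnj (c v) * wnorm2 m v)" for d
    unfolding c wip_sum_right wip_scale_right
    by (intro sum.cong) (simp_all add: wip_orthogonal_sum[OF orth fin] wip_self mult_ac)
  have n: "wnorm2 m f = (\<Sum>v\<in>C. (cmod (c v))\<^sup>2 * wnorm2 m v)"
  proof -
    have "complex_of_real (wnorm2 m f) = complex_of_real (\<Sum>v\<in>C. (cmod (c v))\<^sup>2 * wnorm2 m v)"
      using expand[of c] by (simp flip: c wip_self complex_norm_square)
    then show ?thesis
      by (simp only: of_real_eq_iff)
  qed
  have q: "qform f = (\<Sum>v\<in>C. e v * ((cmod (c v))\<^sup>2 * wnorm2 m v))"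
  proof -
    have "wip m (S f) f = (\<Sum>v\<in>C. complex_of_real (e v) * (c v * cnj (c v)) * wnorm2 m v)"
      unfolding Sf expand by (simp add: mult_ac)
    also have "\<dots> = complex_of_real (\<Sum>v\<in>C. e v * ((cmod (c v))\<^sup>2 * wnorm2 m v))"
      by (simp add: mult_ac flip: complex_norm_square)
    finally show ?thesis
      by (simp add: qform_def)
  qed
  have nonneg: "0 \<le> (cmod (c v))\<^sup>2 * wnorm2 m v" for v
    unfolding wnorm2_def using weight_pos
    by (intro mult_nonneg_nonneg sum_nonneg) (auto simp: less_imp_le)
  show "qform f \<le> t * wnorm2 m f" if "\<And>v. v \<in> C \<Longrightarrow> e v \<le> t"
    unfolding n q sum_distrib_left using that nonneg by (intro sum_mono mult_right_mono)
  show "t * wnorm2 m f \<le> qform f" if "\<And>v. v \<in> C \<Longrightarrow> t \<le> e v"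
    unfolding n q sum_distrib_left using that nonneg by (intro sum_mono mult_right_mono)
qed

text \<open>The space is spanned by all basis vectors with eigenvalue at most \<open>t\<close>. Ties
  with \<open>t\<close> can only enlarge it, hence an inequality for the dimension.\<close>

lemma lower_spectral_subspace:
  assumes "1 \<le> k" "k \<le> CARD('v)"
  obtains U where "vec.subspace U" "k \<le> vec.dim U"
    "\<And>f. f \<in> U \<Longrightarrow> qform f \<le> nth_eigenvalue k S * wnorm2 m f"
proof -
  obtain B e where B: "eigenbasis B e"
    using exists_eigenbasis by blast
  define t where "t = nth_eigenvalue k S"
  define C where "C = {v \<in> B. e v \<le> t}"
  let ?l = "eigenvalue_list S"
  \<comment> \<open>List positions start at 0, so the \<open>k\<close>-th eigenvalue sits at
    \<open>k - 1\<close> and the first \<open>k\<close> entries are at most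
    \<open>t\<close>.\<close>
  have "{..<k} \<subseteq> {i. i < length ?l \<and> ?l ! i \<le> t}"
    using assms sorted_nth_mono[OF sorted_eigenvalue_list]
    by (auto simp: length_eigenvalue_list t_def nth_eigenvalue_def)
  from card_mono[OF _ this] have "k \<le> card C"
    using length_filter_eigenvalue_list[OF B, of "\<lambda>x. x \<le> t"]
    by (simp add: C_def length_filter_conv_card)
  moreover have "vec.dim (vec.span C) = card C"
    by (intro vec.dim_span_eq_card_independent vec.independent_mono[OF eigenbasis_independent[OF B]])
      (auto simp: C_def)
  ultimately show thesis
    using that[of "vec.span C"] qform_span_bounds(1)[OF B, of C _ t]
    by (auto simp: C_def t_def)
qed

lemma upper_spectral_subspace:
  assumes "1 \<le> k" "k \<le> CARD('v)"
  obtains U where "vec.subspace U" "CARD('v) + 1 - k \<le> vec.dim U"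
    "\<And>f. f \<in> U \<Longrightarrow> nth_eigenvalue k S * wnorm2 m f \<le> qform f"
proof -
  obtain B e where B: "eigenbasis B e"
    using exists_eigenbasis by blast
  define t where "t = nth_eigenvalue k S"
  define C where "C = {v \<in> B. t \<le> e v}"
  let ?l = "eigenvalue_list S"
  \<comment> \<open>The position \<open>k - 1\<close> of \<open>t\<close> itself is included, which
    gives \<open>CARD('v) + 1 - k\<close> entries.\<close>
  have "{k - 1..<CARD('v)} \<subseteq> {i. i < length ?l \<and> t \<le> ?l ! i}"
    using assms sorted_nth_mono[OF sorted_eigenvalue_list]
    by (auto simp: length_eigenvalue_list t_def nth_eigenvalue_def)
  from card_mono[OF _ this] have "CARD('v) + 1 - k \<le> card C"
    using length_filter_eigenvalue_list[OF B, of "\<lambda>x. t \<le> x"] assms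
    by (simp add: C_def length_filter_conv_card)
  moreover have "vec.dim (vec.span C) = card C"
    by (intro vec.dim_span_eq_card_independent vec.independent_mono[OF eigenbasis_independent[OF B]])
      (auto simp: C_def)
  ultimately show thesis
    using that[of "vec.span C"] qform_span_bounds(2)[OF B, of C _ t]
    by (auto simp: C_def t_def)
qed

end

section \<open>Weyl inequalities\<close>

text \<open>Intersecting two subspaces gives dimension at least the sum of theirs minus
  \<open>CARD('v)\<close>. Two intersections cost \<open>2 * CARD('v)\<close> in total.\<close>

lemma common_nonzero_vector:
  fixes U V W :: "('a::field ^ 'v::finite) set"
  assumes "vec.subspace U" "vec.subspace V" "vec.subspace W"
    and "2 * CARD('v) < vec.dim U + vec.dim V + vec.dim W"
  obtains f where "f \<noteq> 0" "f \<in> U" "f \<in> V" "f \<in> W"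
proof -
  have le: "vec.dim X \<le> CARD('v)" for X :: "('a ^ 'v) set"
    by (rule dim_subset_UNIV_cart_gen)
  have Int: "vec.dim X + vec.dim Y \<le> CARD('v) + vec.dim (X \<inter> Y)"
    if "vec.subspace X" "vec.subspace Y" for X Y :: "('a ^ 'v) set"
    using vec.dim_sums_Int[OF that] le[of "{x + y |x y. x \<in> X \<and> y \<in> Y}"] by simp
  have "0 < vec.dim (U \<inter> V \<inter> W)"
    using Int[OF assms(1,2)] Int[OF vec.subspace_inter[OF assms(1,2)] assms(3)] assms(4) by simp
  then have "\<not> U \<inter> V \<inter> W \<subseteq> {0}"
    using vec.dim_eq_0[of "U \<inter> V \<inter> W"] by linarith
  then show thesis
    using that by blast
qed

text \<open>No relation between the operators is built in: each Weyl bound assumes just a one-sided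
  comparison of the forms.\<close>

locale selfadjoint3 =
  A: selfadjoint m A + B: selfadjoint m B + C: selfadjoint m C
  for m :: "'v::finite \<Rightarrow> real" and A B C
begin

lemma weyl_upper:
  assumes le: "\<And>f. A.qform f \<le> B.qform f + C.qform f"
    and "1 \<le> k" "k + j \<le> CARD('v)"
  shows "nth_eigenvalue k A \<le> nth_eigenvalue (k + j) B + nth_eigenvalue (CARD('v) - j) C"
proof -
  have l: "1 \<le> CARD('v) - j" "CARD('v) - j \<le> CARD('v)"
    using assms by auto
  obtain U where U: "vec.subspace U" "CARD('v) + 1 - k \<le> vec.dim U"
    "\<And>f. f \<in> U \<Longrightarrow> nth_eigenvalue k A * wnorm2 m f \<le> A.qform f"
    using A.upper_spectral_subspace[of k] assms by auto
  obtain V where V: "vec.subspace V" "k + j \<le> vec.dim V"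
    "\<And>f. f \<in> V \<Longrightarrow> B.qform f \<le> nth_eigenvalue (k + j) B * wnorm2 m f"
    using B.lower_spectral_subspace[of "k + j"] assms by auto
  obtain W where W: "vec.subspace W" "CARD('v) - j \<le> vec.dim W"
    "\<And>f. f \<in> W \<Longrightarrow> C.qform f \<le> nth_eigenvalue (CARD('v) - j) C * wnorm2 m f"
    using C.lower_spectral_subspace[OF l] by blast
  obtain f where f: "f \<noteq> 0" "f \<in> U" "f \<in> V" "f \<in> W"
    proof (rule common_nonzero_vector[OF U(1) V(1) W(1)])
    \<comment> \<open>With \<open>n = CARD('v)\<close>, the bounds add up to
      \<open>(n + 1 - k) + (k + j) + (n - j) = 2 * n + 1\<close>.\<close>
    show "2 * CARD('v) < vec.dim U + vec.dim V + vec.dim W"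
      using U(2) V(2) W(2) assms(2,3) by linarith
  qed blast
  have "nth_eigenvalue k A * wnorm2 m f \<le>
      (nth_eigenvalue (k + j) B + nth_eigenvalue (CARD('v) - j) C) * wnorm2 m f"
    using U(3)[OF f(2)] V(3)[OF f(3)] W(3)[OF f(4)] le[of f] by (simp add: distrib_right)
  then show ?thesis
    using wnorm2_pos[of m f, OF A.weight_pos f(1)] by simp
qed

lemma weyl_lower:
  assumes le: "\<And>f. B.qform f + C.qform f \<le> A.qform f"
    and "1 \<le> j" "j \<le> k" "k \<le> CARD('v)"
  shows "nth_eigenvalue (k - j + 1) B + nth_eigenvalue j C \<le> nth_eigenvalue k A"
proof -
  have l: "1 \<le> k - j + 1" "k - j + 1 \<le> CARD('v)"
    using assms by auto
  obtain U where U: "vec.subspace U" "k \<le> vec.dim U"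
    "\<And>f. f \<in> U \<Longrightarrow> A.qform f \<le> nth_eigenvalue k A * wnorm2 m f"
    using A.lower_spectral_subspace[of k] assms by auto
  obtain V where V: "vec.subspace V" "CARD('v) + 1 - (k - j + 1) \<le> vec.dim V"
    "\<And>f. f \<in> V \<Longrightarrow> nth_eigenvalue (k - j + 1) B * wnorm2 m f \<le> B.qform f"
    using B.upper_spectral_subspace[OF l] by blast
  obtain W where W: "vec.subspace W" "CARD('v) + 1 - j \<le> vec.dim W"
    "\<And>f. f \<in> W \<Longrightarrow> nth_eigenvalue j C * wnorm2 m f \<le> C.qform f"
    using C.upper_spectral_subspace[of j] assms by auto
  obtain f where f: "f \<noteq> 0" "f \<in> U" "f \<in> V" "f \<in> W"
    proof (rule common_nonzero_vector[OF U(1) V(1) W(1)])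
    \<comment> \<open>With \<open>n = CARD('v)\<close>, the bounds add up to
      \<open>k + (n - k + j) + (n + 1 - j) = 2 * n + 1\<close>.\<close>
    show "2 * CARD('v) < vec.dim U + vec.dim V + vec.dim W"
      using U(2) V(2) W(2) assms(2-4) by linarith
  qed blast
  have "(nth_eigenvalue (k - j + 1) B + nth_eigenvalue j C) * wnorm2 m f \<le>
      nth_eigenvalue k A * wnorm2 m f"
    using U(3)[OF f(2)] V(3)[OF f(3)] W(3)[OF f(4)] le[of f] by (simp add: distrib_right)
  then show ?thesis
    using wnorm2_pos[of m f, OF A.weight_pos f(1)] by simp
qed

end

section \<open>The special Laplacian\<close>

text \<open>Green's formula: extend the inner sum from neighbours to all vertices, then average the
  double sum with its copy under exchange of \<open>x\<close> and \<open>y\<close>. The factor 2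
  avoids halves.\<close>

lemma wip_special_laplacian:
  fixes w :: "'v::finite \<Rightarrow> 'v \<Rightarrow> real"
  assumes pos: "\<And>x. 0 < m x" and supp: "{(x, y). w x y \<noteq> 0} \<subseteq> E"
  shows "2 * wip m (special_laplacian E w m f) g =
    (\<Sum>x\<in>UNIV. \<Sum>y\<in>UNIV. complex_of_real (w x y + w y x) * (f $ x - f $ y) * cnj (g $ x - g $ y))"
proof -
  define a where "a x y = complex_of_real (w x y + w y x)" for x y
  have "w x y = 0" if "(x, y) \<notin> E" for x y
    using supp that by blast
  then have a_zero: "a x y = 0" if "y \<notin> nbrs E x" for x y
    using that by (simp add: a_def nbrs_def out_nbrs_def in_nbrs_def)
  have a_commute: "a x y = a y x" for x y
    by (simp add: a_def add.commute)
  have "(\<Sum>y\<in>nbrs E x. a x y * (f $ x - f $ y)) = (\<Sum>y\<in>UNIV. a x y * (f $ x - f $ y))" for x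
    by (intro sum.mono_neutral_left) (auto simp: a_zero)
  then have "complex_of_real (m x) * special_laplacian E w m f $ x =
      (\<Sum>y\<in>UNIV. a x y * (f $ x - f $ y))" for x
    using less_imp_neq[OF pos[of x]] by (simp add: special_laplacian_def a_def)
  then have L: "wip m (special_laplacian E w m f) g =
      (\<Sum>x\<in>UNIV. \<Sum>y\<in>UNIV. a x y * (f $ x - f $ y) * cnj (g $ x))"
    by (simp add: wip_def sum_distrib_right)
  also have "\<dots> = (\<Sum>x\<in>UNIV. \<Sum>y\<in>UNIV. a y x * (f $ y - f $ x) * cnj (g $ y))"
    by (rule sum.swap)
  also have "\<dots> = (\<Sum>x\<in>UNIV. \<Sum>y\<in>UNIV. - (a x y * (f $ x - f $ y) * cnj (g $ y)))"
    by (intro sum.cong refl) (simp add: a_commute algebra_simps)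
  finally have R: "wip m (special_laplacian E w m f) g =
      (\<Sum>x\<in>UNIV. \<Sum>y\<in>UNIV. - (a x y * (f $ x - f $ y) * cnj (g $ y)))" .
  have "2 * wip m (special_laplacian E w m f) g =
      (\<Sum>x\<in>UNIV. \<Sum>y\<in>UNIV. a x y * (f $ x - f $ y) * cnj (g $ x)) +
      (\<Sum>x\<in>UNIV. \<Sum>y\<in>UNIV. - (a x y * (f $ x - f $ y) * cnj (g $ y)))"
    unfolding mult_2 by (rule arg_cong2[OF L R])
  also have "\<dots> = (\<Sum>x\<in>UNIV. \<Sum>y\<in>UNIV. a x y * (f $ x - f $ y) * cnj (g $ x - g $ y))"
    unfolding sum.distrib[symmetric] by (intro sum.cong refl) (simp add: algebra_simps)
  finally show ?thesis
    by (simp only: a_def)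
qed

text \<open>Symmetry is read off Green's formula: with real weights, exchanging \<open>f\<close> and
  \<open>g\<close> conjugates every summand.\<close>

lemma selfadjoint_special_laplacian:
  fixes w :: "'v::finite \<Rightarrow> 'v \<Rightarrow> real"
  assumes pos: "\<And>x. 0 < m x" and supp: "{(x, y). w x y \<noteq> 0} \<subseteq> E"
  shows "selfadjoint m (special_laplacian E w m)"
proof
  fix f g :: "complex ^ 'v" and c x
  let ?L = "special_laplacian E w m"
  show "0 < m x"
    by (rule pos)
  show "?L (f + g) = ?L f + ?L g"
    by (simp add: special_laplacian_def vec_eq_iff algebra_simps sum.distrib sum_subtractf
        add_divide_distrib diff_divide_distrib)
  show "?L (c *s f) = c *s ?L f"
    by (simp add: special_laplacian_def vec_eq_iff sum_distrib_left algebra_simps)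
  have "2 * wip m (?L f) g = cnj (2 * wip m (?L g) f)"
    unfolding wip_special_laplacian[of m w E, OF pos supp] cnj_sum
    by (intro sum.cong refl) (simp add: mult_ac)
  then show "wip m (?L f) g = wip m f (?L g)"
    using wip_commute[of m f "?L g"] by simp
qed

text \<open>This is the Dirichlet energy, which is monotone in the edge weights; comparing operators
  thus reduces to comparing weights.\<close>

lemma qform_special_laplacian:
  fixes w :: "'v::finite \<Rightarrow> 'v \<Rightarrow> real"
  assumes pos: "\<And>x. 0 < m x" and supp: "{(x, y). w x y \<noteq> 0} \<subseteq> E"
  shows "2 * selfadjoint.qform m (special_laplacian E w m) f =
    (\<Sum>x\<in>UNIV. \<Sum>y\<in>UNIV. (w x y + w y x) * (cmod (f $ x - f $ y))\<^sup>2)"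
proof -
  have "2 * wip m (special_laplacian E w m f) f =
      complex_of_real (\<Sum>x\<in>UNIV. \<Sum>y\<in>UNIV. (w x y + w y x) * (cmod (f $ x - f $ y))\<^sup>2)"
    unfolding wip_special_laplacian[of m w E, OF pos supp] of_real_sum of_real_mult complex_norm_square
    by (simp add: mult.assoc)
  from arg_cong[OF this, of Re] show ?thesis
    by (simp add: selfadjoint.qform_def[OF selfadjoint_special_laplacian[of m w E, OF pos supp]])
qed

text \<open>Covering of all arcs is a premise of the upper bounds alone. In the two-vertex example
  with one arc dropped, \<open>k = 2\<close> and \<open>j = 0\<close> would give
  \<open>4 \<le> 2 + 0\<close>.\<close>

theorem proposition3p1:
  fixes E :: "('v::finite \<times> 'v) set"
    and b :: "'v \<Rightarrow> 'v \<Rightarrow> real"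
    and m :: "'v \<Rightarrow> real"
    and F :: "nat \<Rightarrow> ('v \<times> 'v) set"
    and S_G :: "complex ^ 'v \<Rightarrow> complex ^ 'v"
    and S :: "nat \<Rightarrow> complex ^ 'v \<Rightarrow> complex ^ 'v"
    and n k r s :: nat
  defines "S_G \<equiv> special_laplacian E b m"
    and "S \<equiv> \<lambda>i. special_laplacian (F i) (partial_weight b (F i)) m"
  assumes "standing_digraph E b m"
    and "n = CARD('v)"
    and "F 1 \<subseteq> E" and "F 2 \<subseteq> E"
    and "undirected_edges E = undirected_edges (F 1) \<union> undirected_edges (F 2)"
    and "undirected_edges (F 1) \<inter> undirected_edges (F 2) = {}"
    and "k \<in> {1..n}"
    and "r \<in> {1, 2}" and "s \<in> {1, 2}" and "r \<noteq> s"
  shows "(E = F 1 \<union> F 2 \<longrightarrow>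
            (\<forall>j\<in>{0..n - k}. nth_eigenvalue k S_G
               \<le> nth_eigenvalue (k + j) (S s) + nth_eigenvalue (n - j) (S r))) \<and>
         (\<forall>j\<in>{1..k}. nth_eigenvalue k S_G
               \<ge> nth_eigenvalue (k - j + 1) (S s) + nth_eigenvalue j (S r))"
proof -
  interpret G: standing_digraph E b m
    by fact
  note pos = G.m_pos
  have b_zero: "b x y = 0" if "(x, y) \<notin> E" for x y
    using that G.b_nonneg[of x y] G.b_pos_iff[of x y] by linarith
  then have supp: "{(x, y). b x y \<noteq> 0} \<subseteq> E"
    by blast
  have supp_partial: "{(x, y). partial_weight b (F i) x y \<noteq> 0} \<subseteq> F i" for i
    by (auto simp: partial_weight_def)
  interpret A: selfadjoint m S_G
    unfolding S_G_def using pos supp by (rule selfadjoint_special_laplacian)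
  interpret B: selfadjoint m "S s"
    unfolding S_def using pos supp_partial by (rule selfadjoint_special_laplacian)
  interpret C: selfadjoint m "S r"
    unfolding S_def using pos supp_partial by (rule selfadjoint_special_laplacian)
  interpret ABC: selfadjoint3 m S_G "S s" "S r" ..
  define a where "a x y = b x y + b y x" for x y
  define p where
    "p i x y = partial_weight b (F i) x y + partial_weight b (F i) y x" for i x y
  have rs: "r = 1 \<and> s = 2 \<or> r = 2 \<and> s = 1"
    using assms by auto
  \<comment> \<open>A common arc would yield a common undirected edge. So no arc is counted twice in
    \<open>p s x y + p r x y\<close>.\<close>
  have disjoint: "F 1 \<inter> F 2 = {}"
  proof (rule ccontr)
    assume "F 1 \<inter> F 2 \<noteq> {}"
    then obtain x y where "(x, y) \<in> F 1" "(x, y) \<in> F 2"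
      by auto
    then have "{x, y} \<in> undirected_edges (F 1) \<inter> undirected_edges (F 2)"
      unfolding undirected_edges_def by blast
    then show False
      using assms(8) by blast
  qed
  \<comment> \<open>Each arc keeps its weight in at most one partial graph; an arc in neither adds a
    nonnegative amount to \<open>a x y\<close> only.\<close>
  have le: "p s x y + p r x y \<le> a x y" for x y
    using rs disjoint G.b_nonneg[of x y] G.b_nonneg[of y x]
    by (auto simp: a_def p_def partial_weight_def)
  \<comment> \<open>Now each arc of \<open>E\<close> keeps its weight in exactly one partial graph,
    and off \<open>E\<close> all weights are 0.\<close>
  have eq: "p s x y + p r x y = a x y" if "E = F 1 \<union> F 2" for x y
    using rs disjoint b_zero[of x y] b_zero[of y x] that
    by (auto simp: a_def p_def partial_weight_def)
  have qA: "2 * A.qform f = (\<Sum>x\<in>UNIV. \<Sum>y\<in>UNIV. a x y * (cmod (f $ x - f $ y))\<^sup>2)" for f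
    unfolding S_G_def a_def using pos supp by (rule qform_special_laplacian)
  have qS: "2 * (B.qform f + C.qform f) =
      (\<Sum>x\<in>UNIV. \<Sum>y\<in>UNIV. (p s x y + p r x y) * (cmod (f $ x - f $ y))\<^sup>2)" for f
  proof -
    have "2 * selfadjoint.qform m (S i) f =
        (\<Sum>x\<in>UNIV. \<Sum>y\<in>UNIV. p i x y * (cmod (f $ x - f $ y))\<^sup>2)" for i
      unfolding S_def p_def using pos supp_partial by (rule qform_special_laplacian)
    then show ?thesis
      by (simp add: distrib_left distrib_right sum.distrib)
  qed
  have lower: "B.qform f + C.qform f \<le> A.qform f" for f
  proof -
    have "2 * (B.qform f + C.qform f) \<le> 2 * A.qform f"
      unfolding qA qS by (intro sum_mono mult_right_mono le) simp
    then show ?thesis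
      by simp
  qed
  have upper: "A.qform f \<le> B.qform f + C.qform f" if "E = F 1 \<union> F 2" for f
    using qA[of f] qS[of f] by (simp add: eq[OF that])
  show ?thesis
    using ABC.weyl_upper[OF upper] ABC.weyl_lower[OF lower] assms(4,9) by auto
qed

end
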